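(* Let $p,q$ be distinct propositional variables. The formula $p\rhd q$, which is left-modalized in $p$, has no fixed point in $\mathbf{IL}^-(\mathbf{J1},\mathbf{J5})$. That is, for any formula $A$ which satisfies $v(A)\subseteq\{q\}$, $$\mathbf{IL}^-(\mathbf{J1},\mathbf{J5}) \nvdash A \leftrightarrow (A\rhd q).$$
   Context: Formulas are generated by $A ::= \bot \mid p \mid A \to A \mid \Box A \mid A \rhd A$, where $p$ ranges over a countably infinite set of propositional variables. The symbols $\neg,\land,\lor,\leftrightarrow,\top,\Diamond$ (with $\Diamond A := \neg\Box\neg A$) are the usual abbreviations. $\neg,\Box,\Diamond$ bind most strongly. $v(A)$ is the set of propositional variables contained in $A$. A formula $A$ is left-modalized in $p$ if every occurrence of $p$ in $A$ is in the scope of some $\Box$ or $\rhd$, and $p\notin v(C)$ for any subformula $B\rhd C$ of $A$. The logic $\mathbf{IL}^-$ has as axioms all instances of: $\mathbf{L1}$: all tautologies in this language; $\mathbf{L2}$: $\Box(A\to B)\to(\Box A\to\Box B)$; $\mathbf{L3}$: $\Box(\Box A\to A)\to\Box A$; $\mathbf{J3}$: $((A\rhd C)\land(B\rhd C))\to((A\lor B)\rhd C)$; $\mathbf{J6}$: $\Box A\leftrightarrow((\neg A)\rhd\bot)$. Its inference rules are Modus Ponens, Necessitation (from $A$ infer $\Box A$), $\mathbf{R1}$ (from $A\to B$ infer $(C\rhd A)\to(C\rhd B)$) and $\mathbf{R2}$ (from $A\to B$ infer $(B\rhd C)\to(A\rhd C)$). $\mathbf{IL}^-(\Sigma_1,\ldots,\Sigma_n)$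 is the logic obtained from $\mathbf{IL}^-$ by adding the schemata $\Sigma_1,\ldots,\Sigma_n$ as axiom schemata (with the same rules). $\mathbf{J1}$ is the schema $\Box(A\to B)\to(A\rhd B)$ and $\mathbf{J5}$ is the schema $\Diamond A\rhd A$. $L\nvdash A$ means that $A$ is not a theorem of $L$. *)

theory Defs
  imports Main
begin

datatype fm =
    Bot  ("\<^bold>\<bottom>")
  | Var nat
  | Imp fm fm  (infixr "\<^bold>\<rightarrow>" 55)
  | Box fm  ("\<^bold>\<box> _" [80] 80)
  | Rhd fm fm  (infix "\<^bold>\<rhd>" 60)

abbreviation Neg :: "fm \<Rightarrow> fm" ("\<^bold>\<not> _" [80] 80) where
  "\<^bold>\<not> A \<equiv> A \<^bold>\<rightarrow> \<^bold>\<bottom>"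

abbreviation Top :: fm ("\<^bold>\<top>") where
  "\<^bold>\<top> \<equiv> \<^bold>\<not> \<^bold>\<bottom>"

abbreviation Conj :: "fm \<Rightarrow> fm \<Rightarrow> fm" (infixr "\<^bold>\<and>" 75) where
  "A \<^bold>\<and> B \<equiv> \<^bold>\<not> (A \<^bold>\<rightarrow> \<^bold>\<not> B)"

abbreviation Disj :: "fm \<Rightarrow> fm \<Rightarrow> fm" (infixr "\<^bold>\<or>" 70) where
  "A \<^bold>\<or> B \<equiv> \<^bold>\<not> A \<^bold>\<rightarrow> B"

abbreviation Iff :: "fm \<Rightarrow> fm \<Rightarrow> fm" (infix "\<^bold>\<leftrightarrow>" 53) where
  "A \<^bold>\<leftrightarrow> B \<equiv> (A \<^bold>\<rightarrow> B) \<^bold>\<and> (B \<^bold>\<rightarrow> A)"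

abbreviation Dia :: "fm \<Rightarrow> fm" ("\<^bold>\<diamond> _" [80] 80) where
  "\<^bold>\<diamond> A \<equiv> \<^bold>\<not> \<^bold>\<box> \<^bold>\<not> A"

fun vars :: "fm \<Rightarrow> nat set" where
  "vars \<^bold>\<bottom> = {}"
| "vars (Var x) = {x}"
| "vars (A \<^bold>\<rightarrow> B) = vars A \<union> vars B"
| "vars (\<^bold>\<box> A) = vars A"
| "vars (A \<^bold>\<rhd> B) = vars A \<union> vars B"

fun subfms :: "fm \<Rightarrow> fm set" where
  "subfms \<^bold>\<bottom> = {\<^bold>\<bottom>}"
| "subfms (Var x) = {Var x}"
| "subfms (A \<^bold>\<rightarrow> B) = insert (A \<^bold>\<rightarrow> B) (subfms A \<union> subfms B)"
| "subfms (\<^bold>\<box> A) = insert (\<^bold>\<box> A) (subfms A)"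
| "subfms (A \<^bold>\<rhd> B) = insert (A \<^bold>\<rhd> B) (subfms A \<union> subfms B)"

text \<open>Every occurrence of the variable lies in the scope of some \<open>\<^bold>\<box>\<close> or \<open>\<^bold>\<rhd>\<close>
  (either argument of \<open>\<^bold>\<rhd>\<close> counts as its scope).\<close>

fun modalized :: "nat \<Rightarrow> fm \<Rightarrow> bool" where
  "modalized p \<^bold>\<bottom> \<longleftrightarrow> True"
| "modalized p (Var x) \<longleftrightarrow> x \<noteq> p"
| "modalized p (A \<^bold>\<rightarrow> B) \<longleftrightarrow> modalized p A \<and> modalized p B"
| "modalized p (\<^bold>\<box> A) \<longleftrightarrow> True"
| "modalized p (A \<^bold>\<rhd> B) \<longleftrightarrow> True"

definition left_modalized :: "nat \<Rightarrow> fm \<Rightarrow> bool" where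
  "left_modalized p A \<longleftrightarrow>
     modalized p A \<and> (\<forall>B C. B \<^bold>\<rhd> C \<in> subfms A \<longrightarrow> p \<notin> vars C)"

text \<open>Tautologies of the modal language: variables and formulas with outermost
  \<open>\<^bold>\<box>\<close> or \<open>\<^bold>\<rhd>\<close> are the propositional atoms, whose truth values \<open>e\<close> assigns arbitrarily
  (the values of \<open>e\<close> on other formulas are irrelevant).\<close>

fun truth :: "(fm \<Rightarrow> bool) \<Rightarrow> fm \<Rightarrow> bool" where
  "truth e \<^bold>\<bottom> \<longleftrightarrow> False"
| "truth e (Var x) \<longleftrightarrow> e (Var x)"
| "truth e (A \<^bold>\<rightarrow> B) \<longleftrightarrow> (truth e A \<longrightarrow> truth e B)"
| "truth e (\<^bold>\<box> A) \<longleftrightarrow> e (\<^bold>\<box> A)"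
| "truth e (A \<^bold>\<rhd> B) \<longleftrightarrow> e (A \<^bold>\<rhd> B)"

definition tautology :: "fm \<Rightarrow> bool" where
  "tautology A \<longleftrightarrow> (\<forall>e. truth e A)"

text \<open>\<open>IL_minus \<Sigma>\<close> is the set of theorems of the logic \<open>IL\<^sup>-\<close> extended by
  all members of \<open>\<Sigma>\<close> as axioms; a schema is given as the set of its instances.\<close>

inductive_set IL_minus :: "fm set \<Rightarrow> fm set" for \<Sigma> :: "fm set" where
  L1: "tautology A \<Longrightarrow> A \<in> IL_minus \<Sigma>"
| L2: "\<^bold>\<box> (A \<^bold>\<rightarrow> B) \<^bold>\<rightarrow> (\<^bold>\<box> A \<^bold>\<rightarrow> \<^bold>\<box> B) \<in> IL_minus \<Sigma>"
| L3: "\<^bold>\<box> (\<^bold>\<box> A \<^bold>\<rightarrow> A) \<^bold>\<rightarrow> \<^bold>\<box> A \<in> IL_minus \<Sigma>"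
| J3: "((A \<^bold>\<rhd> C) \<^bold>\<and> (B \<^bold>\<rhd> C)) \<^bold>\<rightarrow> ((A \<^bold>\<or> B) \<^bold>\<rhd> C) \<in> IL_minus \<Sigma>"
| J6: "\<^bold>\<box> A \<^bold>\<leftrightarrow> ((\<^bold>\<not> A) \<^bold>\<rhd> \<^bold>\<bottom>) \<in> IL_minus \<Sigma>"
| Ax: "A \<in> \<Sigma> \<Longrightarrow> A \<in> IL_minus \<Sigma>"
| MP: "A \<^bold>\<rightarrow> B \<in> IL_minus \<Sigma> \<Longrightarrow> A \<in> IL_minus \<Sigma> \<Longrightarrow> B \<in> IL_minus \<Sigma>"
| Nec: "A \<in> IL_minus \<Sigma> \<Longrightarrow> \<^bold>\<box> A \<in> IL_minus \<Sigma>"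
| R1: "A \<^bold>\<rightarrow> B \<in> IL_minus \<Sigma> \<Longrightarrow> (C \<^bold>\<rhd> A) \<^bold>\<rightarrow> (C \<^bold>\<rhd> B) \<in> IL_minus \<Sigma>"
| R2: "A \<^bold>\<rightarrow> B \<in> IL_minus \<Sigma> \<Longrightarrow> (B \<^bold>\<rhd> C) \<^bold>\<rightarrow> (A \<^bold>\<rhd> C) \<in> IL_minus \<Sigma>"

definition schema_J1 :: "fm set" where
  "schema_J1 = {\<^bold>\<box> (A \<^bold>\<rightarrow> B) \<^bold>\<rightarrow> (A \<^bold>\<rhd> B) | A B. True}"

definition schema_J5 :: "fm set" where
  "schema_J5 = {(\<^bold>\<diamond> A) \<^bold>\<rhd> A | A. True}"

end

(* The countermodel is a Veltman model for IL^- whose points are the naturals and one extra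
   R-isolated point None.  The point i sees exactly the j < i, and j S_i k holds for k \<le> j < i,
   as J1 and J5 demand; moreover j S_i None holds when j < i - 1.  Variables are true at None only.
   A solution of A \<leftrightarrow> (A \<rhd> q) holds at i + 1 iff it fails at i, since all points below i reach
   None via S_(i+1) and i itself does not, and no point reaches q otherwise.  But every formula
   has an eventually constant truth value along the naturals. *)
theory Submission
  imports Defs
begin

fun sat :: "nat option \<Rightarrow> fm \<Rightarrow> bool" where
  "sat w \<^bold>\<bottom> \<longleftrightarrow> False"
| "sat w (Var x) \<longleftrightarrow> w = None"
| "sat w (A \<^bold>\<rightarrow> B) \<longleftrightarrow> (sat w A \<longrightarrow> sat w B)"
| "sat w (\<^bold>\<box> A) \<longleftrightarrow> (\<forall>i. w = Some i \<longrightarrow> (\<forall>j<i. sat (Some j) A))"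
| "sat w (A \<^bold>\<rhd> B) \<longleftrightarrow> (\<forall>i. w = Some i \<longrightarrow> (\<forall>j<i. sat (Some j) A \<longrightarrow>
     (\<exists>k\<le>j. sat (Some k) B) \<or> Suc j < i \<and> sat None B))"

text \<open>\<open>sat w\<close> serves as the assignment to the modal atoms, which makes all
  tautologies sound.\<close>

lemma truth_sat: "truth (sat w) A = sat w A"
  by (induction A) auto

text \<open>Strong induction on \<open>j < i\<close>: the points below \<open>j\<close> are also
  below \<open>i\<close>, so the induction hypothesis yields \<open>\<box> A\<close> at
  \<open>j\<close>.\<close>

lemma sat_Loeb: "sat w (\<^bold>\<box> (\<^bold>\<box> A \<^bold>\<rightarrow> A) \<^bold>\<rightarrow> \<^bold>\<box> A)"
proof (cases w)
  case (Some i)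
  have "sat (Some j) A" if "\<forall>j<i. sat (Some j) (\<^bold>\<box> A \<^bold>\<rightarrow> A)" "j < i" for j
    using that(2)
  proof (induction j rule: less_induct)
    case (less j)
    then show ?case using that(1) by fastforce
  qed
  moreover have "sat w (\<^bold>\<box> B) \<longleftrightarrow> (\<forall>j<i. sat (Some j) B)" for B
    using Some by simp
  ultimately show ?thesis by (metis sat.simps(3))
qed simp

lemma sat_J1: "A \<in> schema_J1 \<Longrightarrow> sat w A"
  unfolding schema_J1_def by fastforce

lemma sat_J5: "A \<in> schema_J5 \<Longrightarrow> sat w A"
  unfolding schema_J5_def by (auto intro: less_imp_le)

lemma soundness:
  assumes "A \<in> IL_minus (schema_J1 \<union> schema_J5)"
  shows "sat w A"
  using assms
proof (induction arbitrary: w rule: IL_minus.induct)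
  case (L1 A)
  then show ?case unfolding tautology_def using truth_sat by blast
next
  case (L3 A)
  then show ?case by (rule sat_Loeb)
next
  case (Ax A)
  then show ?case using sat_J1 sat_J5 by blast
next
  case (R1 A B C)
  then show ?case by simp blast
qed auto

text \<open>The delicate case is \<open>\<rhd>\<close>, whose value at \<open>i\<close> may depend
  on \<open>A\<close> at \<open>i - 1\<close>.\<close>

lemma eventually_constant_sat: "\<exists>n b. \<forall>i\<ge>n. sat (Some i) A = b"
proof (induction A)
  case (Imp A B)
  then obtain m n a b where "\<forall>i\<ge>m. sat (Some i) A = a" "\<forall>i\<ge>n. sat (Some i) B = b"
    by blast
  then show ?case by (intro exI[of _ "max m n"] exI[of _ "a \<longrightarrow> b"]) simp
next
  case (Box A)
  show ?case
  proof (cases "\<forall>j. sat (Some j) A")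
    case False
    then obtain j where "\<not> sat (Some j) A" by blast
    then show ?thesis by (intro exI[of _ "Suc j"] exI[of _ False]) (auto simp: Suc_le_eq)
  qed auto
next
  case (Rhd A B)
  then obtain m a where m: "\<forall>i\<ge>m. sat (Some i) A = a" by blast
  show ?case
  proof (cases "sat None B")
    case True
    show ?thesis
    proof (cases "\<exists>k. sat (Some k) B")
      case True
      then obtain k where "sat (Some k) B" by blast
      \<comment> \<open>Points \<open>j \<ge> k\<close> reach \<open>k\<close> itself; points
        \<open>j < k\<close> have \<open>Suc j \<le> k < i\<close> and reach
        \<open>None\<close>.\<close>
      then have "(\<exists>l\<le>j. sat (Some l) B) \<or> Suc j < i" if "Suc k < i" for i j
        using that by (cases "k \<le> j") auto
      with \<open>sat None B\<close> show ?thesis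
        by (intro exI[of _ "Suc (Suc k)"] exI[of _ True]) (auto simp: Suc_le_eq)
    next
      case False
      \<comment> \<open>\<open>B\<close> holds at \<open>None\<close> alone, so only
        \<open>j = i - 1\<close> can fail, and it does iff \<open>A\<close> holds there;
        \<open>Suc m\<close> ensures \<open>m \<le> i - 1\<close>.\<close>
      have "sat (Some i) (A \<^bold>\<rhd> B) = (\<not> a)" if "i \<ge> Suc m" for i
      proof -
        obtain l where l: "i = Suc l" "m \<le> l" using \<open>i \<ge> Suc m\<close> by (cases i) auto
        then show ?thesis using True False m by (auto simp: less_Suc_eq)
      qed
      then show ?thesis by blast
    qed
  next
    case False
    show ?thesis
    \<comment> \<open>Without \<open>None\<close>, the condition on \<open>j\<close> does not
      mention \<open>i\<close>, so one bad \<open>j\<close> refutes the formula at every later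
      point.\<close>
    proof (cases "\<forall>j. sat (Some j) A \<longrightarrow> (\<exists>k\<le>j. sat (Some k) B)")
      case False
      then obtain j where "sat (Some j) A" "\<not> (\<exists>k\<le>j. sat (Some k) B)" by blast
      with \<open>\<not> sat None B\<close> show ?thesis
        by (intro exI[of _ "Suc j"] exI[of _ False]) (auto simp: Suc_le_eq)
    qed auto
  qed
qed auto

theorem theorem6p3:
  fixes p q :: nat
  assumes "p \<noteq> q"
  shows "left_modalized p (Var p \<^bold>\<rhd> Var q) \<and>
    (\<forall>A. vars A \<subseteq> {q} \<longrightarrow>
      (A \<^bold>\<leftrightarrow> (A \<^bold>\<rhd> Var q)) \<notin> IL_minus (schema_J1 \<union> schema_J5))"
proof (intro conjI allI impI notI)
  show "left_modalized p (Var p \<^bold>\<rhd> Var q)"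
    using assms by (simp add: left_modalized_def)
next
  fix A
  assume "(A \<^bold>\<leftrightarrow> (A \<^bold>\<rhd> Var q)) \<in> IL_minus (schema_J1 \<union> schema_J5)"
  then have fixed_point: "sat (Some i) A = sat (Some i) (A \<^bold>\<rhd> Var q)" for i
    using soundness[of _ "Some i"] by fastforce
  have alternating: "sat (Some (Suc i)) A = (\<not> sat (Some i) A)" for i
    \<comment> \<open>\<open>less_Suc_eq\<close> splits off \<open>j = i\<close>, the only point
      below \<open>Suc i\<close> that does not reach \<open>None\<close>.\<close>
    unfolding fixed_point[of "Suc i"] by (auto simp: less_Suc_eq)
  obtain n b where "\<forall>i\<ge>n. sat (Some i) A = b"
    using eventually_constant_sat by blast
  then show False using alternating[of n] by simp
qed

end
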